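(* (1) If $(R,\ast,\odot,P)$ is a Rota-Baxter totally compatible dialgebra, then $(R,\prec_P,\succ_P,\cdot_P)$ defined by $$x\prec_P y:=x\ast P(y),\quad x\succ_P y:=P(x)\ast y,\quad x\cdot_P y:=x\odot y,\quad \forall x,y\in R,$$ is a tridendriform algebra. (2) If $P$ is surjective, then the converse of (1) holds. That is: let $R$ be a $\mathbf{k}$-module with two associative (bilinear) multiplications $\ast,\odot$ and a surjective linear map $P:R\to R$ such that $P(x)\ast P(y)=P(x\ast P(y)+P(x)\ast y+x\odot y)$ for all $x,y\in R$; if $(R,\prec_P,\succ_P,\cdot_P)$, with the operations defined by the formulas in (1), is a tridendriform algebra, then $(R,\ast,\odot,P)$ is a Rota-Baxter totally compatible dialgebra. (3) Let $R$ be a $\mathbf{k}$-algebra, let $P:R\to R$ be a linear operator, and let $w\in R$ be such that $wP(x)=P(x)w$ for all $x\in R$. Let $(R,P)$ be a Rota-Baxter algebra of weight $w$, that is, $$P(x)P(y)=P(xP(y))+P(P(x)y)+P(xwy),\quad \forall x,y\in R.$$ Then $$x\prec_P y:=xP(y),\quad x\succ_P y:=P(x)y,\quad x\cdot_P y:=xwy,\quad \forall x,y\in R,$$ define a tridendriform algebra structure on $R$. (4) Let $(R,P)$ be a TD algebra. Then $$x\prec_P y:=xP(y),\quad x\succ_P y:=P(x)y,\quad x\cdot_P y:=-xP(1)y,\quad \forall x,y\in R,$$ define a tridendriform algebra structure on $R$.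
   Context: $\mathbf{k}$ is a commutative unitary ring; $\mathbf{k}$-algebras are associative and not assumed unitary unless stated. A tridendriform algebra is a quadruple $(T,\prec,\succ,\cdot)$ consisting of a $\mathbf{k}$-module $T$ and three bilinear products such that, for all $x,y,z\in T$, with $\star=\prec+\succ+\cdot$: $(x\prec y)\prec z=x\prec(y\star z)$, $(x\succ y)\prec z=x\succ(y\prec z)$, $(x\star y)\succ z=x\succ(y\succ z)$, $(x\succ y)\cdot z=x\succ(y\cdot z)$, $(x\prec y)\cdot z=x\cdot(y\succ z)$, $(x\cdot y)\prec z=x\cdot(y\prec z)$, $(x\cdot y)\cdot z=x\cdot(y\cdot z)$. A totally compatible dialgebra is a $\mathbf{k}$-module $R$ with two bilinear binary operations $\ast,\odot$ that are both associative and satisfy $(a\ast b)\odot c=a\ast(b\odot c)=(a\odot b)\ast c=a\odot(b\ast c)$ for all $a,b,c\in R$. A Rota-Baxter totally compatible dialgebra is a quadruple $(R,\ast,\odot,P)$ where $(R,\ast,\odot)$ is a totally compatible dialgebra and $P:R\to R$ is a linear operator with $P(x)\ast P(y)=P(x\ast P(y))+P(P(x)\ast y)+P(x\odot y)$ for all $x,y\in R$. A TD algebra is a pair $(R,P)$ where $R$ is a unitary $\mathbf{k}$-algebra with identity $1$ and $P:R\to R$ is a TD operator, that is, a linear operator with $P(x)P(y)=P(xP(y))+P(P(x)y)-P(xP(1)y)$ for all $x,y\in R$. *)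

theory Defs
  imports "HOL-Algebra.Module"
begin

(* The ground ring is a cring (the zero ring is allowed) and the underlying spaces are
   modules in the sense of HOL-Algebra. Everything is relativised to carriers; the values of
   the operations outside the carrier are irrelevant. *)

definition linear_operator ::
  "('k, 'm) ring_scheme \<Rightarrow> ('k, 'a, 'n) module_scheme \<Rightarrow> ('a \<Rightarrow> 'a) \<Rightarrow> bool" where
  "linear_operator k M f \<longleftrightarrow>
     f \<in> carrier M \<rightarrow> carrier M \<and>
     (\<forall>x\<in>carrier M. \<forall>y\<in>carrier M. f (x \<oplus>\<^bsub>M\<^esub> y) = f x \<oplus>\<^bsub>M\<^esub> f y) \<and>
     (\<forall>c\<in>carrier k. \<forall>x\<in>carrier M. f (c \<odot>\<^bsub>M\<^esub> x) = c \<odot>\<^bsub>M\<^esub> f x)"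

definition bilinear_product ::
  "('k, 'm) ring_scheme \<Rightarrow> ('k, 'a, 'n) module_scheme \<Rightarrow> ('a \<Rightarrow> 'a \<Rightarrow> 'a) \<Rightarrow> bool" where
  "bilinear_product k M f \<longleftrightarrow>
     (\<forall>x\<in>carrier M. linear_operator k M (\<lambda>y. f x y)) \<and>
     (\<forall>y\<in>carrier M. linear_operator k M (\<lambda>x. f x y))"

definition associative_product ::
  "('k, 'a, 'n) module_scheme \<Rightarrow> ('a \<Rightarrow> 'a \<Rightarrow> 'a) \<Rightarrow> bool" where
  "associative_product M f \<longleftrightarrow>
     (\<forall>x\<in>carrier M. \<forall>y\<in>carrier M. \<forall>z\<in>carrier M. f (f x y) z = f x (f y z))"

(* The product is the multiplication field of the module record; the field one is unconstrained,
   since algebras need not be unitary. The locale algebra of HOL-Algebra would force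
   commutativity and a unit. *)
locale assoc_algebra = module k A for k (structure) and A (structure) +
  assumes mult_bilinear: "bilinear_product k A (\<lambda>x y. x \<otimes>\<^bsub>A\<^esub> y)"
    and mult_assoc: "associative_product A (\<lambda>x y. x \<otimes>\<^bsub>A\<^esub> y)"

locale unital_assoc_algebra = assoc_algebra k A + monoid A for k (structure) and A (structure)

locale tridendriform_algebra = module k T for k (structure) and T (structure) +
  fixes prec :: "'c \<Rightarrow> 'c \<Rightarrow> 'c" (infixl \<open>\<prec>\<close> 70)
    and succ :: "'c \<Rightarrow> 'c \<Rightarrow> 'c" (infixl \<open>\<succ>\<close> 70)
    and dot :: "'c \<Rightarrow> 'c \<Rightarrow> 'c" (infixl \<open>\<bullet>\<close> 70)
  assumes prec_bilinear: "bilinear_product k T (\<prec>)"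
    and succ_bilinear: "bilinear_product k T (\<succ>)"
    and dot_bilinear: "bilinear_product k T (\<bullet>)"
    and prec_prec:
      "\<lbrakk>x \<in> carrier T; y \<in> carrier T; z \<in> carrier T\<rbrakk> \<Longrightarrow>
        (x \<prec> y) \<prec> z = x \<prec> ((y \<prec> z) \<oplus>\<^bsub>T\<^esub> (y \<succ> z) \<oplus>\<^bsub>T\<^esub> (y \<bullet> z))"
    and succ_prec:
      "\<lbrakk>x \<in> carrier T; y \<in> carrier T; z \<in> carrier T\<rbrakk> \<Longrightarrow>
        (x \<succ> y) \<prec> z = x \<succ> (y \<prec> z)"
    and star_succ:
      "\<lbrakk>x \<in> carrier T; y \<in> carrier T; z \<in> carrier T\<rbrakk> \<Longrightarrow>
        ((x \<prec> y) \<oplus>\<^bsub>T\<^esub> (x \<succ> y) \<oplus>\<^bsub>T\<^esub> (x \<bullet> y)) \<succ> z = x \<succ> (y \<succ> z)"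
    and succ_dot:
      "\<lbrakk>x \<in> carrier T; y \<in> carrier T; z \<in> carrier T\<rbrakk> \<Longrightarrow>
        (x \<succ> y) \<bullet> z = x \<succ> (y \<bullet> z)"
    and prec_dot:
      "\<lbrakk>x \<in> carrier T; y \<in> carrier T; z \<in> carrier T\<rbrakk> \<Longrightarrow>
        (x \<prec> y) \<bullet> z = x \<bullet> (y \<succ> z)"
    and dot_prec:
      "\<lbrakk>x \<in> carrier T; y \<in> carrier T; z \<in> carrier T\<rbrakk> \<Longrightarrow>
        (x \<bullet> y) \<prec> z = x \<bullet> (y \<prec> z)"
    and dot_dot:
      "\<lbrakk>x \<in> carrier T; y \<in> carrier T; z \<in> carrier T\<rbrakk> \<Longrightarrow>
        (x \<bullet> y) \<bullet> z = x \<bullet> (y \<bullet> z)"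

(* In the dialgebra locales the multiplicative fields of the module record play no role:
   p and q are the two products, written ast and odot on paper. *)
locale totally_compatible_dialgebra = module k R for k (structure) and R (structure) +
  fixes p :: "'c \<Rightarrow> 'c \<Rightarrow> 'c" and q :: "'c \<Rightarrow> 'c \<Rightarrow> 'c"
  assumes p_bilinear: "bilinear_product k R p"
    and q_bilinear: "bilinear_product k R q"
    and p_assoc: "associative_product R p"
    and q_assoc: "associative_product R q"
    and compatible:
      "\<lbrakk>a \<in> carrier R; b \<in> carrier R; c \<in> carrier R\<rbrakk> \<Longrightarrow>
        q (p a b) c = p a (q b c) \<and> p a (q b c) = p (q a b) c \<and> p (q a b) c = q a (p b c)"

locale rota_baxter_tc_dialgebra = totally_compatible_dialgebra k R p q
    for k (structure) and R (structure) and p and q +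
  fixes P :: "'c \<Rightarrow> 'c"
  assumes P_linear: "linear_operator k R P"
    and rota_baxter:
      "\<lbrakk>x \<in> carrier R; y \<in> carrier R\<rbrakk> \<Longrightarrow>
        p (P x) (P y) = P (p x (P y)) \<oplus>\<^bsub>R\<^esub> P (p (P x) y) \<oplus>\<^bsub>R\<^esub> P (q x y)"

locale rota_baxter_algebra = assoc_algebra k R for k (structure) and R (structure) +
  fixes w :: 'c and P :: "'c \<Rightarrow> 'c"
  assumes weight_closed: "w \<in> carrier R"
    and P_linear: "linear_operator k R P"
    and rota_baxter:
      "\<lbrakk>x \<in> carrier R; y \<in> carrier R\<rbrakk> \<Longrightarrow>
        P x \<otimes>\<^bsub>R\<^esub> P y =
          P (x \<otimes>\<^bsub>R\<^esub> P y) \<oplus>\<^bsub>R\<^esub> P (P x \<otimes>\<^bsub>R\<^esub> y) \<oplus>\<^bsub>R\<^esub> P (x \<otimes>\<^bsub>R\<^esub> w \<otimes>\<^bsub>R\<^esub> y)"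

locale TD_algebra = unital_assoc_algebra k R for k (structure) and R (structure) +
  fixes P :: "'c \<Rightarrow> 'c"
  assumes P_linear: "linear_operator k R P"
    and TD:
      "\<lbrakk>x \<in> carrier R; y \<in> carrier R\<rbrakk> \<Longrightarrow>
        P x \<otimes>\<^bsub>R\<^esub> P y =
          (P (x \<otimes>\<^bsub>R\<^esub> P y) \<oplus>\<^bsub>R\<^esub> P (P x \<otimes>\<^bsub>R\<^esub> y))
            \<ominus>\<^bsub>R\<^esub> P (x \<otimes>\<^bsub>R\<^esub> P \<one>\<^bsub>R\<^esub> \<otimes>\<^bsub>R\<^esub> y)"

end

theory Submission
  imports Defs
begin

text \<open>
  Let \<open>x \<prec> y = p x (P y)\<close>, \<open>x \<succ> y = p (P x) y\<close>, and write \<open>x \<star> y\<close> for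
  \<open>x \<prec> y + x \<succ> y + q x y\<close>. The Rota-Baxter equation says exactly that \<open>P\<close> is
  multiplicative from \<open>\<star>\<close> to \<open>p\<close>. Hence the two axioms that contain \<open>\<star>\<close> reduce to associativity
  of \<open>p\<close>. The remaining axioms contain no sum and are instances of
  associativity or of compatibility between \<open>p\<close> and \<open>q\<close>; but compatibility is only needed when one of
  the three factors, in a definite position, is a value of \<open>P\<close>. The lemma
  \<open>tridendriform_algebra_if_compatible_on_image\<close> isolates this weak requirement.

  A totally compatible dialgebra satisfies the requirement for arbitrary factors. Conversely, if \<open>P\<close> is
  surjective, then every element is a value of \<open>P\<close>, and the three restricted identities chain together
  to total compatibility. For a Rota-Baxter operator of weight \<open>w\<close>, the product \<open>q x y = x w y\<close> need
  not be compatible with multiplication, since this would force \<open>x y w z = x w y z\<close> for all \<open>y\<close>; the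
  restricted form has this identity only for values \<open>y\<close> of \<open>P\<close>, with which \<open>w\<close> is
  assumed to commute. Finally, a TD operator is a Rota-Baxter operator of weight \<open>- P 1\<close>, and specialising one argument of the TD equation to \<open>1\<close>
  makes both \<open>P 1 P x\<close> and \<open>P x P 1\<close> equal to \<open>P (P x)\<close>, so this weight commutes with the values of \<open>P\<close>.
\<close>

section \<open>Linear operators and bilinear products\<close>

lemma linear_operator_closed:
  "linear_operator k M f \<Longrightarrow> x \<in> carrier M \<Longrightarrow> f x \<in> carrier M"
  by (auto simp: linear_operator_def)

lemma linear_operator_add:
  "linear_operator k M f \<Longrightarrow> x \<in> carrier M \<Longrightarrow> y \<in> carrier M \<Longrightarrow>
    f (x \<oplus>\<^bsub>M\<^esub> y) = f x \<oplus>\<^bsub>M\<^esub> f y"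
  by (simp add: linear_operator_def)

lemma linear_operator_compose:
  assumes "linear_operator k M f" and "linear_operator k M g"
  shows "linear_operator k M (\<lambda>x. f (g x))"
  using assms by (auto simp: linear_operator_def Pi_iff)

lemma (in module) linear_operator_minus:
  assumes f: "linear_operator R M f" and x: "x \<in> carrier M"
  shows "f (\<ominus>\<^bsub>M\<^esub> x) = \<ominus>\<^bsub>M\<^esub> f x"
proof -
  have "f (\<ominus>\<^bsub>M\<^esub> x) = f ((\<ominus> \<one>) \<odot>\<^bsub>M\<^esub> x)"
    using x by (simp add: smult_l_minus)
  also have "\<dots> = (\<ominus> \<one>) \<odot>\<^bsub>M\<^esub> f x"
    using f x by (simp add: linear_operator_def)
  also have "\<dots> = \<ominus>\<^bsub>M\<^esub> f x"
    using linear_operator_closed[OF f x] by (simp add: smult_l_minus)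
  finally show ?thesis .
qed

lemma bilinear_product_linear_left:
  "bilinear_product k M f \<Longrightarrow> y \<in> carrier M \<Longrightarrow> linear_operator k M (\<lambda>x. f x y)"
  by (simp add: bilinear_product_def)

lemma bilinear_product_linear_right:
  "bilinear_product k M f \<Longrightarrow> x \<in> carrier M \<Longrightarrow> linear_operator k M (\<lambda>y. f x y)"
  by (simp add: bilinear_product_def)

lemma bilinear_product_closed:
  assumes "bilinear_product k M f" and "x \<in> carrier M" and "y \<in> carrier M"
  shows "f x y \<in> carrier M"
  using bilinear_product_linear_right[OF assms(1,2)] assms(3) by (rule linear_operator_closed)

lemma bilinear_product_compose_left:
  assumes "bilinear_product k M f" and "linear_operator k M g"
  shows "bilinear_product k M (\<lambda>x y. f (g x) y)"
  unfolding bilinear_product_def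
proof (intro conjI ballI)
  fix x assume "x \<in> carrier M"
  then show "linear_operator k M (\<lambda>y. f (g x) y)"
    by (rule bilinear_product_linear_right[OF assms(1) linear_operator_closed[OF assms(2)]])
next
  fix y assume "y \<in> carrier M"
  then show "linear_operator k M (\<lambda>x. f (g x) y)"
    by (rule linear_operator_compose[OF bilinear_product_linear_left[OF assms(1)] assms(2)])
qed

lemma bilinear_product_compose_right:
  assumes "bilinear_product k M f" and "linear_operator k M g"
  shows "bilinear_product k M (\<lambda>x y. f x (g y))"
  unfolding bilinear_product_def
proof (intro conjI ballI)
  fix x assume "x \<in> carrier M"
  then show "linear_operator k M (\<lambda>y. f x (g y))"
    by (rule linear_operator_compose[OF bilinear_product_linear_right[OF assms(1)] assms(2)])
next
  fix y assume "y \<in> carrier M"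
  then show "linear_operator k M (\<lambda>x. f x (g y))"
    by (rule bilinear_product_linear_left[OF assms(1) linear_operator_closed[OF assms(2)]])
qed

lemma (in module) bilinear_product_cong:
  assumes f: "bilinear_product R M f"
    and eq: "\<And>x y. x \<in> carrier M \<Longrightarrow> y \<in> carrier M \<Longrightarrow> g x y = f x y"
  shows "bilinear_product R M g"
  using f by (auto simp: bilinear_product_def linear_operator_def Pi_iff eq)

lemma associative_productD:
  "associative_product M f \<Longrightarrow> x \<in> carrier M \<Longrightarrow> y \<in> carrier M \<Longrightarrow> z \<in> carrier M \<Longrightarrow>
    f (f x y) z = f x (f y z)"
  by (simp add: associative_product_def)

section \<open>Rota-Baxter operators on totally compatible dialgebras\<close>

text \<open>
  The left side is \<open>P\<close> of the sum of the three tridendriform operations, as it occurs in the axioms;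
  the right side is the expression in the Rota-Baxter equation.
\<close>
lemma (in module) rota_baxter_collect:
  assumes P: "linear_operator R M P"
    and p: "bilinear_product R M p" and q: "bilinear_product R M q"
    and x: "x \<in> carrier M" and y: "y \<in> carrier M"
  shows "P (p x (P y) \<oplus>\<^bsub>M\<^esub> p (P x) y \<oplus>\<^bsub>M\<^esub> q x y) =
    P (p x (P y)) \<oplus>\<^bsub>M\<^esub> P (p (P x) y) \<oplus>\<^bsub>M\<^esub> P (q x y)"
  using x y
  by (simp add: linear_operator_add[OF P] linear_operator_closed[OF P]
      bilinear_product_closed[OF p] bilinear_product_closed[OF q])

text \<open>
  Each compatibility hypothesis carries \<open>P\<close> exactly where the corresponding tridendriform axiom
  does. This restricted form is what a Rota-Baxter operator of weight \<open>w\<close> provides as soon as \<open>w\<close>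
  commutes with the values of \<open>P\<close>.
\<close>
lemma (in module) tridendriform_algebra_if_compatible_on_image:
  assumes P: "linear_operator R M P"
    and p: "bilinear_product R M p" and q: "bilinear_product R M q"
    and p_assoc: "associative_product M p" and q_assoc: "associative_product M q"
    and rota_baxter: "\<And>x y. \<lbrakk>x \<in> carrier M; y \<in> carrier M\<rbrakk> \<Longrightarrow>
      p (P x) (P y) = P (p x (P y)) \<oplus>\<^bsub>M\<^esub> P (p (P x) y) \<oplus>\<^bsub>M\<^esub> P (q x y)"
    and left: "\<And>x y z. \<lbrakk>x \<in> carrier M; y \<in> carrier M; z \<in> carrier M\<rbrakk> \<Longrightarrow>
      q (p (P x) y) z = p (P x) (q y z)"
    and middle: "\<And>x y z. \<lbrakk>x \<in> carrier M; y \<in> carrier M; z \<in> carrier M\<rbrakk> \<Longrightarrow>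
      q (p x (P y)) z = q x (p (P y) z)"
    and right: "\<And>x y z. \<lbrakk>x \<in> carrier M; y \<in> carrier M; z \<in> carrier M\<rbrakk> \<Longrightarrow>
      p (q x y) (P z) = q x (p y (P z))"
  shows "tridendriform_algebra R M (\<lambda>x y. p x (P y)) (\<lambda>x y. p (P x) y) (\<lambda>x y. q x y)"
proof
  show "bilinear_product R M (\<lambda>x y. p x (P y))"
    using p P by (rule bilinear_product_compose_right)
  show "bilinear_product R M (\<lambda>x y. p (P x) y)"
    using p P by (rule bilinear_product_compose_left)
  show "bilinear_product R M (\<lambda>x y. q x y)"
    by (rule q)
next
  fix x y z
  assume x: "x \<in> carrier M" and y: "y \<in> carrier M" and z: "z \<in> carrier M"
  note PM = linear_operator_closed[OF P]
  have mult: "P (p a (P b) \<oplus>\<^bsub>M\<^esub> p (P a) b \<oplus>\<^bsub>M\<^esub> q a b) = p (P a) (P b)"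
    if "a \<in> carrier M" "b \<in> carrier M" for a b
    using that by (simp add: rota_baxter_collect[OF P p q] rota_baxter)
  show "p (p x (P y)) (P z) = p x (P (p y (P z) \<oplus>\<^bsub>M\<^esub> p (P y) z \<oplus>\<^bsub>M\<^esub> q y z))"
    using x y z by (simp add: mult associative_productD[OF p_assoc] PM)
  show "p (P (p x (P y) \<oplus>\<^bsub>M\<^esub> p (P x) y \<oplus>\<^bsub>M\<^esub> q x y)) z = p (P x) (p (P y) z)"
    using x y z by (simp add: mult associative_productD[OF p_assoc] PM)
  show "p (p (P x) y) (P z) = p (P x) (p y (P z))"
    using x y z by (simp add: associative_productD[OF p_assoc] PM)
  show "q (q x y) z = q x (q y z)"
    using x y z by (rule associative_productD[OF q_assoc])
  show "q (p (P x) y) z = p (P x) (q y z)"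
    using x y z by (rule left)
  show "q (p x (P y)) z = q x (p (P y) z)"
    using x y z by (rule middle)
  show "p (q x y) (P z) = q x (p y (P z))"
    using x y z by (rule right)
qed

lemma (in rota_baxter_tc_dialgebra) tridendriform_algebra_dialgebra:
  "tridendriform_algebra k R (\<lambda>x y. p x (P y)) (\<lambda>x y. p (P x) y) (\<lambda>x y. q x y)"
  using P_linear p_bilinear q_bilinear p_assoc q_assoc rota_baxter
proof (rule tridendriform_algebra_if_compatible_on_image)
  fix x y z
  assume x: "x \<in> carrier R" and y: "y \<in> carrier R" and z: "z \<in> carrier R"
  note PR = linear_operator_closed[OF P_linear]
  show "q (p (P x) y) z = p (P x) (q y z)"
    using compatible[OF PR[OF x] y z] by simp
  show "q (p x (P y)) z = q x (p (P y) z)"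
    using compatible[OF x PR[OF y] z] by simp
  show "p (q x y) (P z) = q x (p y (P z))"
    using compatible[OF x y PR[OF z]] by simp
qed

text \<open>
  The tridendriform axioms that mix \<open>p\<close> and \<open>q\<close> are the compatibility identities with one factor
  restricted to values of \<open>P\<close>; surjectivity removes the restriction.
\<close>
lemma rota_baxter_tc_dialgebra_if_surjective:
  assumes p: "bilinear_product k R p" and p_assoc: "associative_product R p"
    and q: "bilinear_product k R q" and q_assoc: "associative_product R q"
    and P: "linear_operator k R P" and surj: "P ` carrier R = carrier R"
    and mult: "\<And>x y. \<lbrakk>x \<in> carrier R; y \<in> carrier R\<rbrakk> \<Longrightarrow>
      p (P x) (P y) = P (p x (P y) \<oplus>\<^bsub>R\<^esub> p (P x) y \<oplus>\<^bsub>R\<^esub> q x y)"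
    and T: "tridendriform_algebra k R (\<lambda>x y. p x (P y)) (\<lambda>x y. p (P x) y) (\<lambda>x y. q x y)"
  shows "rota_baxter_tc_dialgebra k R p q P"
proof -
  interpret T: tridendriform_algebra k R "\<lambda>x y. p x (P y)" "\<lambda>x y. p (P x) y" "\<lambda>x y. q x y"
    by (rule T)
  show ?thesis
  proof
    fix a b c
    assume a: "a \<in> carrier R" and b: "b \<in> carrier R" and c: "c \<in> carrier R"
    \<comment> \<open>Each axiom relating \<open>p\<close> and \<open>q\<close> has \<open>P\<close> on a different factor, so all three preimages are needed.\<close>
    have "a \<in> P ` carrier R" "b \<in> P ` carrier R" "c \<in> P ` carrier R"
      using a b c by (simp_all add: surj)
    then obtain a' b' c'
      where a': "a' \<in> carrier R" "a = P a'"
        and b': "b' \<in> carrier R" "b = P b'"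
        and c': "c' \<in> carrier R" "c = P c'"
      by blast
    have "q (p a b) c = p a (q b c)"
      using T.succ_dot[OF a'(1) b c] a'(2) by simp
    moreover have "q (p a b) c = q a (p b c)"
      using T.prec_dot[OF a b'(1) c] b'(2) by simp
    moreover have "p (q a b) c = q a (p b c)"
      using T.dot_prec[OF a b c'(1)] c'(2) by simp
    ultimately show "q (p a b) c = p a (q b c) \<and> p a (q b c) = p (q a b) c \<and>
        p (q a b) c = q a (p b c)"
      by simp
  next
    fix x y
    assume "x \<in> carrier R" and "y \<in> carrier R"
    then show "p (P x) (P y) = P (p x (P y)) \<oplus>\<^bsub>R\<^esub> P (p (P x) y) \<oplus>\<^bsub>R\<^esub> P (q x y)"
      by (simp add: mult T.rota_baxter_collect[OF P p q])
  qed (fact p p_assoc q q_assoc P)+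
qed

section \<open>Rota-Baxter operators with a weight\<close>

text \<open>
  The third operation is only required to agree with \<open>x w y\<close> on the carrier, so that the lemma
  also covers \<open>- (x v y)\<close>, the natural way to write the operation of weight \<open>- v\<close>.
\<close>
lemma (in rota_baxter_algebra) tridendriform_algebra_weight:
  assumes comm: "\<And>x. x \<in> carrier R \<Longrightarrow> w \<otimes>\<^bsub>R\<^esub> P x = P x \<otimes>\<^bsub>R\<^esub> w"
    and q: "\<And>x y. x \<in> carrier R \<Longrightarrow> y \<in> carrier R \<Longrightarrow> q x y = x \<otimes>\<^bsub>R\<^esub> w \<otimes>\<^bsub>R\<^esub> y"
  shows "tridendriform_algebra k R
    (\<lambda>x y. x \<otimes>\<^bsub>R\<^esub> P y) (\<lambda>x y. P x \<otimes>\<^bsub>R\<^esub> y) (\<lambda>x y. q x y)"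
  using P_linear mult_bilinear
proof (rule tridendriform_algebra_if_compatible_on_image)
  note PR = linear_operator_closed[OF P_linear]
    and mult_closed = bilinear_product_closed[OF mult_bilinear]
    and assoc = associative_productD[OF mult_assoc]
    and w = weight_closed
  have "bilinear_product k R (\<lambda>x y. x \<otimes>\<^bsub>R\<^esub> w \<otimes>\<^bsub>R\<^esub> y)"
    using mult_bilinear bilinear_product_linear_left[OF mult_bilinear w]
    by (rule bilinear_product_compose_left)
  then show "bilinear_product k R q"
    by (rule bilinear_product_cong) (rule q)
  show "associative_product R (\<lambda>x y. x \<otimes>\<^bsub>R\<^esub> y)"
    by (rule mult_assoc)
  show "associative_product R q"
    by (simp add: associative_product_def q assoc mult_closed w)
  fix x y z
  assume x: "x \<in> carrier R" and y: "y \<in> carrier R" and z: "z \<in> carrier R"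
  show "P x \<otimes>\<^bsub>R\<^esub> P y =
      P (x \<otimes>\<^bsub>R\<^esub> P y) \<oplus>\<^bsub>R\<^esub> P (P x \<otimes>\<^bsub>R\<^esub> y) \<oplus>\<^bsub>R\<^esub> P (q x y)"
    using x y by (simp add: q rota_baxter)
  show "q (P x \<otimes>\<^bsub>R\<^esub> y) z = P x \<otimes>\<^bsub>R\<^esub> q y z"
    using x y z by (simp add: q assoc mult_closed PR w)
  show "q x y \<otimes>\<^bsub>R\<^esub> P z = q x (y \<otimes>\<^bsub>R\<^esub> P z)"
    using x y z by (simp add: q assoc mult_closed PR w)
  have "q (x \<otimes>\<^bsub>R\<^esub> P y) z = x \<otimes>\<^bsub>R\<^esub> (P y \<otimes>\<^bsub>R\<^esub> w) \<otimes>\<^bsub>R\<^esub> z"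
    using x y z by (simp add: q assoc mult_closed PR w)
  also have "\<dots> = x \<otimes>\<^bsub>R\<^esub> (w \<otimes>\<^bsub>R\<^esub> P y) \<otimes>\<^bsub>R\<^esub> z"
    using y by (simp add: comm)
  also have "\<dots> = q x (P y \<otimes>\<^bsub>R\<^esub> z)"
    using x y z by (simp add: q assoc mult_closed PR w)
  finally show "q (x \<otimes>\<^bsub>R\<^esub> P y) z = q x (P y \<otimes>\<^bsub>R\<^esub> z)" .
qed

section \<open>TD operators\<close>

context TD_algebra
begin

lemma P_closed: "x \<in> carrier R \<Longrightarrow> P x \<in> carrier R"
  using P_linear by (rule linear_operator_closed)

text \<open>
  At \<open>x = 1\<close> the second and third terms of the TD equation cancel, at \<open>y = 1\<close> the first and third; in
  both cases \<open>P (P x)\<close> is left.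
\<close>
lemma P_one_commute:
  assumes x: "x \<in> carrier R"
  shows "P \<one>\<^bsub>R\<^esub> \<otimes>\<^bsub>R\<^esub> P x = P x \<otimes>\<^bsub>R\<^esub> P \<one>\<^bsub>R\<^esub>"
proof -
  have cancel: "(a \<oplus>\<^bsub>R\<^esub> b) \<ominus>\<^bsub>R\<^esub> b = a" "(b \<oplus>\<^bsub>R\<^esub> a) \<ominus>\<^bsub>R\<^esub> b = a"
    if "a \<in> carrier R" "b \<in> carrier R" for a b
    using that by (simp_all add: M.minus_eq M.a_ac M.r_neg)
  have "P \<one>\<^bsub>R\<^esub> \<otimes>\<^bsub>R\<^esub> P x = P (P x)"
    using TD[OF one_closed x] x by (simp add: P_closed cancel)
  moreover have "P x \<otimes>\<^bsub>R\<^esub> P \<one>\<^bsub>R\<^esub> = P (P x)"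
    using TD[OF x one_closed] x by (simp add: P_closed cancel)
  ultimately show ?thesis
    by simp
qed

lemma mult_minus_left:
  assumes "x \<in> carrier R" and "y \<in> carrier R"
  shows "(\<ominus>\<^bsub>R\<^esub> x) \<otimes>\<^bsub>R\<^esub> y = \<ominus>\<^bsub>R\<^esub> (x \<otimes>\<^bsub>R\<^esub> y)"
  using linear_operator_minus[OF bilinear_product_linear_left[OF mult_bilinear assms(2)] assms(1)] .

lemma mult_minus_right:
  assumes "x \<in> carrier R" and "y \<in> carrier R"
  shows "x \<otimes>\<^bsub>R\<^esub> (\<ominus>\<^bsub>R\<^esub> y) = \<ominus>\<^bsub>R\<^esub> (x \<otimes>\<^bsub>R\<^esub> y)"
  using linear_operator_minus[OF bilinear_product_linear_right[OF mult_bilinear assms(1)] assms(2)] .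

lemma rota_baxter_algebra_minus_P_one: "rota_baxter_algebra k R (\<ominus>\<^bsub>R\<^esub> P \<one>\<^bsub>R\<^esub>) P"
proof
  show "\<ominus>\<^bsub>R\<^esub> P \<one>\<^bsub>R\<^esub> \<in> carrier R"
    by (simp add: P_closed)
  show "linear_operator k R P"
    by (rule P_linear)
  fix x y
  assume "x \<in> carrier R" and "y \<in> carrier R"
  then show "P x \<otimes>\<^bsub>R\<^esub> P y = P (x \<otimes>\<^bsub>R\<^esub> P y) \<oplus>\<^bsub>R\<^esub> P (P x \<otimes>\<^bsub>R\<^esub> y) \<oplus>\<^bsub>R\<^esub>
      P (x \<otimes>\<^bsub>R\<^esub> (\<ominus>\<^bsub>R\<^esub> P \<one>\<^bsub>R\<^esub>) \<otimes>\<^bsub>R\<^esub> y)"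
    by (simp add: TD M.minus_eq P_closed mult_minus_left mult_minus_right
        linear_operator_minus[OF P_linear])
qed

lemma tridendriform_algebra_TD:
  "tridendriform_algebra k R (\<lambda>x y. x \<otimes>\<^bsub>R\<^esub> P y) (\<lambda>x y. P x \<otimes>\<^bsub>R\<^esub> y)
    (\<lambda>x y. \<ominus>\<^bsub>R\<^esub> (x \<otimes>\<^bsub>R\<^esub> P \<one>\<^bsub>R\<^esub> \<otimes>\<^bsub>R\<^esub> y))"
  using rota_baxter_algebra_minus_P_one
  by (rule rota_baxter_algebra.tridendriform_algebra_weight)
    (simp_all add: P_closed P_one_commute mult_minus_left mult_minus_right)

end

section \<open>The four constructions together\<close>

theorem corollary3p7:
  fixes k :: "('k, 'm) ring_scheme"
    and R :: "('k, 'a, 'n) module_scheme"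
    and P :: "'a \<Rightarrow> 'a"
  shows
    "(\<forall>p q. rota_baxter_tc_dialgebra k R p q P \<longrightarrow>
        tridendriform_algebra k R (\<lambda>x y. p x (P y)) (\<lambda>x y. p (P x) y) (\<lambda>x y. q x y))
   \<and> (\<forall>p q. module k R
          \<and> bilinear_product k R p \<and> associative_product R p
          \<and> bilinear_product k R q \<and> associative_product R q
          \<and> linear_operator k R P \<and> P ` carrier R = carrier R
          \<and> (\<forall>x\<in>carrier R. \<forall>y\<in>carrier R.
               p (P x) (P y) = P (p x (P y) \<oplus>\<^bsub>R\<^esub> p (P x) y \<oplus>\<^bsub>R\<^esub> q x y))
          \<and> tridendriform_algebra k R (\<lambda>x y. p x (P y)) (\<lambda>x y. p (P x) y) (\<lambda>x y. q x y)
        \<longrightarrow> rota_baxter_tc_dialgebra k R p q P)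
   \<and> (\<forall>w. rota_baxter_algebra k R w P
          \<and> (\<forall>x\<in>carrier R. w \<otimes>\<^bsub>R\<^esub> P x = P x \<otimes>\<^bsub>R\<^esub> w)
        \<longrightarrow> tridendriform_algebra k R
              (\<lambda>x y. x \<otimes>\<^bsub>R\<^esub> P y) (\<lambda>x y. P x \<otimes>\<^bsub>R\<^esub> y) (\<lambda>x y. x \<otimes>\<^bsub>R\<^esub> w \<otimes>\<^bsub>R\<^esub> y))
   \<and> (TD_algebra k R P \<longrightarrow>
        tridendriform_algebra k R
          (\<lambda>x y. x \<otimes>\<^bsub>R\<^esub> P y) (\<lambda>x y. P x \<otimes>\<^bsub>R\<^esub> y)
          (\<lambda>x y. \<ominus>\<^bsub>R\<^esub> (x \<otimes>\<^bsub>R\<^esub> P \<one>\<^bsub>R\<^esub> \<otimes>\<^bsub>R\<^esub> y)))"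
proof (intro conjI allI impI)
  fix p q
  assume "rota_baxter_tc_dialgebra k R p q P"
  then show "tridendriform_algebra k R (\<lambda>x y. p x (P y)) (\<lambda>x y. p (P x) y) (\<lambda>x y. q x y)"
    by (rule rota_baxter_tc_dialgebra.tridendriform_algebra_dialgebra)
next
  fix p q
  assume "module k R
    \<and> bilinear_product k R p \<and> associative_product R p
    \<and> bilinear_product k R q \<and> associative_product R q
    \<and> linear_operator k R P \<and> P ` carrier R = carrier R
    \<and> (\<forall>x\<in>carrier R. \<forall>y\<in>carrier R.
         p (P x) (P y) = P (p x (P y) \<oplus>\<^bsub>R\<^esub> p (P x) y \<oplus>\<^bsub>R\<^esub> q x y))
    \<and> tridendriform_algebra k R (\<lambda>x y. p x (P y)) (\<lambda>x y. p (P x) y) (\<lambda>x y. q x y)"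
  then show "rota_baxter_tc_dialgebra k R p q P"
    by (intro rota_baxter_tc_dialgebra_if_surjective) simp_all
next
  fix w
  assume "rota_baxter_algebra k R w P \<and> (\<forall>x\<in>carrier R. w \<otimes>\<^bsub>R\<^esub> P x = P x \<otimes>\<^bsub>R\<^esub> w)"
  then show "tridendriform_algebra k R
      (\<lambda>x y. x \<otimes>\<^bsub>R\<^esub> P y) (\<lambda>x y. P x \<otimes>\<^bsub>R\<^esub> y) (\<lambda>x y. x \<otimes>\<^bsub>R\<^esub> w \<otimes>\<^bsub>R\<^esub> y)"
    by (intro rota_baxter_algebra.tridendriform_algebra_weight) simp_all
next
  assume "TD_algebra k R P"
  then show "tridendriform_algebra k R
      (\<lambda>x y. x \<otimes>\<^bsub>R\<^esub> P y) (\<lambda>x y. P x \<otimes>\<^bsub>R\<^esub> y)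
      (\<lambda>x y. \<ominus>\<^bsub>R\<^esub> (x \<otimes>\<^bsub>R\<^esub> P \<one>\<^bsub>R\<^esub> \<otimes>\<^bsub>R\<^esub> y))"
    by (rule TD_algebra.tridendriform_algebra_TD)
qed

end
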